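(* Let $t>1$ and let $(d_1,\dots,d_t)$ be any sequence of positive integers. Then $(d_1,\dots,d_t)$ is the central signature of an even-near-critical centrally symmetric allowable sequence $\Pi$ in noncentral general position.
   Context: An allowable sequence on a finite set of $N$ points is a doubly infinite sequence $\Pi=\{\pi_i\}_{i\in\mathbb{Z}}$ of permutations (linear orderings) of the points such that: (i) there is a positive integer $h=h(\Pi)$ such that $\pi_{i+h}$ is the reversal of $\pi_i$ for all $i$ (then $\pi_0,\dots,\pi_h$ is called a halfperiod, of length $h$); (ii) $\pi_i$ is obtained from $\pi_{i-1}$ by reversing one or more disjoint substrings of consecutive elements; these reversals are called switches, and the set of switches from $\pi_{i-1}$ to $\pi_i$ is the $i$-th move; (iii) any pair of points participates together in a switch exactly once within a halfperiod. A switch of two points is a transposition. Write $\pi(p)$ for the position of the point $p$ in $\pi$. An allowable sequence with $2n$ points is centrally symmetric if for every point $p$ there is a point $\overline p$ (its conjugate) with $\pi(p)+\pi(\overline p)=2n+1$ for every permutation $\pi$ of the sequence. A crossing switch is a switch reversing a centered substring of a permutation. The sequence is in noncentral general position if all switches except possibly crossing switches are transpositions. It is even-near-critical if $h(\Pi)=2n$. Its central signature is $(d_1,\dots,d_t)$, where $2d_i$ is the number of points reversed by the $i$-th crossing switch in the halfperiod $\pi_0,\pi_1,\dots,\pi_h$. *)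

theory Defs
  imports "HOL-Library.Disjoint_Sets" "HOL-Combinatorics.Multiset_Permutations"
begin

text \<open>
  A permutation of the finite point set \<open>P\<close> is a list in \<open>permutations_of_set P\<close>, and an
  allowable sequence is a map \<open>\<pi>\<close> from \<open>int\<close> to such lists. A switch is encoded by the pair
  \<open>(a, b)\<close> of the 0-based indices of the first and the last entry of the reversed substring;
  since \<open>a < b\<close>, a switch always involves at least two points.
\<close>

type_synonym switch = "nat \<times> nat"

definition switch_indices :: "switch \<Rightarrow> nat set" where
  "switch_indices s = {fst s..snd s}"

definition switch_points :: "'a list \<Rightarrow> switch \<Rightarrow> 'a set" where
  "switch_points xs s = (\<lambda>k. xs ! k) ` switch_indices s"

definition switch_size :: "switch \<Rightarrow> nat" where
  "switch_size s = card (switch_indices s)"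

definition transposition_switch :: "switch \<Rightarrow> bool" where
  "transposition_switch s \<longleftrightarrow> switch_size s = 2"

text \<open>
  In a permutation of \<open>N\<close> points, the substring \<open>(a, b)\<close> is centered if as many entries precede
  it, namely \<open>a\<close>, as follow it, namely \<open>N - 1 - b\<close>.
\<close>

definition crossing_switch :: "nat \<Rightarrow> switch \<Rightarrow> bool" where
  "crossing_switch N s \<longleftrightarrow> fst s + snd s + 1 = N"

definition obtained_by_switches :: "'a list \<Rightarrow> 'a list \<Rightarrow> switch set \<Rightarrow> bool" where
  "obtained_by_switches xs ys S \<longleftrightarrow>
     length ys = length xs \<and>
     (\<forall>(a, b)\<in>S. a < b \<and> b < length xs) \<and>
     disjoint_family_on switch_indices S \<and>
     (\<forall>(a, b)\<in>S. \<forall>k\<in>{a..b}. ys ! k = xs ! (a + b - k)) \<and>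
     (\<forall>k<length xs. k \<notin> (\<Union>s\<in>S. switch_indices s) \<longrightarrow> ys ! k = xs ! k)"

text \<open>
  The set of switches is determined by the two permutations, so the description operator in
  \<open>move\<close> below is well-defined.
\<close>

lemma obtained_by_switchesD:
  assumes "obtained_by_switches xs ys S" "(a, b) \<in> S"
  shows "a < b" "b < length xs" "a \<le> k \<Longrightarrow> k \<le> b \<Longrightarrow> ys ! k = xs ! (a + b - k)"
proof -
  have "\<forall>k\<in>{a..b}. ys ! k = xs ! (a + b - k)"
    using assms unfolding obtained_by_switches_def by blast
  then show "a \<le> k \<Longrightarrow> k \<le> b \<Longrightarrow> ys ! k = xs ! (a + b - k)" by simp
  show "a < b" "b < length xs" using assms unfolding obtained_by_switches_def by blast+
qed

lemma obtained_by_switches_moved: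
  assumes "obtained_by_switches xs ys S" "k < length xs" "ys ! k \<noteq> xs ! k"
  obtains a b where "(a, b) \<in> S" "a \<le> k" "k \<le> b"
proof -
  have "k \<in> (\<Union>s\<in>S. switch_indices s)"
    using assms unfolding obtained_by_switches_def by blast
  then show thesis using that unfolding switch_indices_def by auto
qed

lemma obtained_by_switches_subset:
  assumes d: "distinct xs" and S: "obtained_by_switches xs ys S"
    and T: "obtained_by_switches xs ys T"
  shows "S \<subseteq> T"
proof
  fix s assume sS: "s \<in> S"
  obtain a b where s: "s = (a, b)" by (cases s)
  have abS: "(a, b) \<in> S" using sS s by simp
  have ab: "a < b" "b < length xs" using obtained_by_switchesD[OF S abS] by blast+
  have ya: "ys ! a = xs ! b" using obtained_by_switchesD(3)[OF S abS, of a] ab by simp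
  have "ys ! a \<noteq> xs ! a" using ya ab d by (simp add: nth_eq_iff_index_eq)
  then obtain c e where t: "(c, e) \<in> T" "c \<le> a" "a \<le> e"
    using obtained_by_switches_moved[OF T, of a] ab by auto
  have ce: "c < e" "e < length xs" using obtained_by_switchesD[OF T t(1)] by blast+
  have "ys ! a = xs ! (c + e - a)" using obtained_by_switchesD(3)[OF T t(1)] t by blast
  moreover have "c + e - a < length xs" using t ce by linarith
  ultimately have sum: "c + e - a = b" using ya ab d by (simp add: nth_eq_iff_index_eq)
  have "c = a"
  proof (rule ccontr)
    assume "c \<noteq> a"
    then have ca: "c < a" using t by simp
    have yc: "ys ! c = xs ! e" using obtained_by_switchesD(3)[OF T t(1), of c] ce by simp
    have "ys ! c \<noteq> xs ! c" using yc ce d by (simp add: nth_eq_iff_index_eq)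
    then obtain f g where u: "(f, g) \<in> S" "f \<le> c" "c \<le> g"
      using obtained_by_switches_moved[OF S, of c] ce by auto
    have "ys ! c = xs ! (f + g - c)" using obtained_by_switchesD(3)[OF S u(1)] u by blast
    moreover have "f + g - c < length xs"
      using u obtained_by_switchesD(2)[OF S u(1)] by linarith
    ultimately have "f + g - c = e" using yc ce d by (simp add: nth_eq_iff_index_eq)
    then have "a \<in> switch_indices (f, g)" "(f, g) \<noteq> (a, b)"
      using u ca t unfolding switch_indices_def by auto
    moreover have "a \<in> switch_indices (a, b)" using ab unfolding switch_indices_def by simp
    moreover have "disjoint_family_on switch_indices S"
      using S unfolding obtained_by_switches_def by simp
    ultimately show False using u(1) abS unfolding disjoint_family_on_def by blast
  qed
  then show "s \<in> T" using sum t s by simp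
qed

lemma obtained_by_switches_unique:
  assumes "distinct xs" "obtained_by_switches xs ys S" "obtained_by_switches xs ys T"
  shows "S = T"
  using obtained_by_switches_subset[OF assms] obtained_by_switches_subset[OF assms(1,3,2)]
  by (rule equalityI)

text \<open>The \<open>i\<close>-th move leads from \<open>\<pi> (i - 1)\<close> to \<open>\<pi> i\<close>.\<close>

definition move :: "(int \<Rightarrow> 'a list) \<Rightarrow> int \<Rightarrow> switch set" where
  "move \<pi> i = (THE S. obtained_by_switches (\<pi> (i - 1)) (\<pi> i) S)"

definition participate_together :: "(int \<Rightarrow> 'a list) \<Rightarrow> int \<Rightarrow> 'a \<Rightarrow> 'a \<Rightarrow> bool" where
  "participate_together \<pi> i p q \<longleftrightarrow> (\<exists>s\<in>move \<pi> i. {p, q} \<subseteq> switch_points (\<pi> (i - 1)) s)"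

text \<open>
  Conditions (i) and (iii) for a given \<open>h\<close>. A halfperiod may start at any \<open>i\<close>; its moves are
  those with index in \<open>{i<..i + h}\<close>. The switches of one move are disjoint, so a pair
  participates together in at most one switch of each move.
\<close>

definition halfperiod_length :: "'a set \<Rightarrow> (int \<Rightarrow> 'a list) \<Rightarrow> nat \<Rightarrow> bool" where
  "halfperiod_length P \<pi> h \<longleftrightarrow>
     h > 0 \<and>
     (\<forall>i. \<pi> (i + int h) = rev (\<pi> i)) \<and>
     (\<forall>p\<in>P. \<forall>q\<in>P. p \<noteq> q \<longrightarrow>
        (\<forall>i. \<exists>!j. j \<in> {i<..i + int h} \<and> participate_together \<pi> j p q))"

definition allowable_sequence :: "'a set \<Rightarrow> (int \<Rightarrow> 'a list) \<Rightarrow> bool" where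
  "allowable_sequence P \<pi> \<longleftrightarrow>
     finite P \<and>
     (\<forall>i. \<pi> i \<in> permutations_of_set P) \<and>
     (\<forall>i. \<exists>S. S \<noteq> {} \<and> obtained_by_switches (\<pi> (i - 1)) (\<pi> i) S) \<and>
     (\<exists>h. halfperiod_length P \<pi> h)"

definition the_halfperiod_length :: "'a set \<Rightarrow> (int \<Rightarrow> 'a list) \<Rightarrow> nat" where
  "the_halfperiod_length P \<pi> = (THE h. halfperiod_length P \<pi> h)"

lemma move_eqI:
  assumes "distinct (\<pi> (i - 1))" "obtained_by_switches (\<pi> (i - 1)) (\<pi> i) S"
  shows "move \<pi> i = S"
  unfolding move_def using assms(2) obtained_by_switches_unique[OF assms(1) _ assms(2)]
  by (rule the_equality)

lemma halfperiod_length_not_less: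
  assumes A: "allowable_sequence P \<pi>" and h: "halfperiod_length P \<pi> h"
    and k: "halfperiod_length P \<pi> k"
  shows "\<not> h < k"
proof
  assume hk: "h < k"
  let ?j = "int h + 1"
  obtain S where S: "S \<noteq> {}" "obtained_by_switches (\<pi> (?j - 1)) (\<pi> ?j) S"
    using A unfolding allowable_sequence_def by blast
  have perm: "set (\<pi> (?j - 1)) = P" "distinct (\<pi> (?j - 1))"
    using A unfolding allowable_sequence_def permutations_of_set_def by auto
  have mv: "move \<pi> ?j = S" using move_eqI[OF perm(2) S(2)] .
  obtain a b where ab: "(a, b) \<in> S" using S(1) by auto
  have lt: "a < b" "b < length (\<pi> (?j - 1))"
    using obtained_by_switchesD[OF S(2) ab] by blast+
  define p where "p = \<pi> (?j - 1) ! a"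
  define q where "q = \<pi> (?j - 1) ! b"
  have pq: "p \<in> P" "q \<in> P" "p \<noteq> q"
    using perm lt nth_mem[of a "\<pi> (?j - 1)"] nth_mem[of b "\<pi> (?j - 1)"]
    unfolding p_def q_def by (auto simp: nth_eq_iff_index_eq)
  have j: "participate_together \<pi> ?j p q"
    unfolding participate_together_def mv switch_points_def switch_indices_def p_def q_def
    using ab lt by (intro bexI[of _ "(a, b)"]) auto
  obtain i where i: "i \<in> {0<..0 + int h}" "participate_together \<pi> i p q"
    using h pq unfolding halfperiod_length_def by blast
  have "\<exists>!j. j \<in> {0<..0 + int k} \<and> participate_together \<pi> j p q"
    using k pq unfolding halfperiod_length_def by blast
  moreover have "?j \<in> {0<..0 + int k}" "i \<in> {0<..0 + int k}" using hk i by auto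
  ultimately have "?j = i" using i(2) j by blast
  then show False using i by auto
qed

lemma the_halfperiod_length_eqI:
  assumes "allowable_sequence P \<pi>" "halfperiod_length P \<pi> h"
  shows "the_halfperiod_length P \<pi> = h"
  unfolding the_halfperiod_length_def
proof (rule the_equality)
  show "k = h" if "halfperiod_length P \<pi> k" for k
    using halfperiod_length_not_less[OF assms that]
      halfperiod_length_not_less[OF assms(1) that assms(2)] by simp
qed (rule assms(2))

text \<open>Positions are numbered from 1.\<close>

definition position :: "'a list \<Rightarrow> 'a \<Rightarrow> nat" where
  "position xs p = Suc (THE k. k < length xs \<and> xs ! k = p)"

definition centrally_symmetric :: "'a set \<Rightarrow> (int \<Rightarrow> 'a list) \<Rightarrow> bool" where
  "centrally_symmetric P \<pi> \<longleftrightarrow>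
     even (card P) \<and>
     (\<forall>p\<in>P. \<exists>p'\<in>P. \<forall>i. position (\<pi> i) p + position (\<pi> i) p' = card P + 1)"

definition noncentral_general_position :: "'a set \<Rightarrow> (int \<Rightarrow> 'a list) \<Rightarrow> bool" where
  "noncentral_general_position P \<pi> \<longleftrightarrow>
     (\<forall>i. \<forall>s\<in>move \<pi> i. crossing_switch (card P) s \<or> transposition_switch s)"

text \<open>With \<open>2 * n\<close> points, even-near-criticality means that the halfperiod has length \<open>2 * n\<close>.\<close>

definition even_near_critical :: "'a set \<Rightarrow> (int \<Rightarrow> 'a list) \<Rightarrow> bool" where
  "even_near_critical P \<pi> \<longleftrightarrow> the_halfperiod_length P \<pi> = card P"

text \<open>
  The moves of the halfperiod \<open>\<pi> 0, \<dots>, \<pi> h\<close> are those with index \<open>1, \<dots>, h\<close>. A move contains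
  at most one crossing switch, because two centered substrings of a permutation of an even
  number of points both contain its two middle entries.
\<close>

definition central_signature :: "'a set \<Rightarrow> (int \<Rightarrow> 'a list) \<Rightarrow> nat list" where
  "central_signature P \<pi> =
     map (\<lambda>i. THE d. \<exists>s\<in>move \<pi> i. crossing_switch (card P) s \<and> switch_size s = 2 * d)
       (filter (\<lambda>i. \<exists>s\<in>move \<pi> i. crossing_switch (card P) s)
          [1..int (the_halfperiod_length P \<pi>)])"

end

theory Submission
  imports Defs
begin

text \<open>
  Let \<open>n\<close> be the sum of the signature. A point and its conjugate can only meet in a crossing switch, so
  the \<open>2 * n\<close> points fall into blocks, the \<open>i\<close>-th crossing switch reversing the \<open>d\<^sub>i\<close> points of the
  \<open>i\<close>-th block together with their conjugates. By symmetry only the right half of the permutations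
  matters: a crossing switch negates its innermost \<open>d\<^sub>i\<close> entries. Between the \<open>i\<close>-th and the next
  crossing switch, the block of the former has to leave the center and the block of the latter has
  to reach it. Exchanging two adjacent blocks of sizes \<open>a\<close> and \<open>b\<close> by adjacent transpositions takes
  \<open>a + b - 1\<close> moves if all points of the blocks march simultaneously, two positions apart from the
  next one. So crossing switches may follow each other at distance \<open>d\<^sub>i + d\<^sub>i\<^sub>+\<^sub>1\<close>, and these
  distances add up to \<open>2 * n\<close> over a halfperiod, which is the length that is needed.

  The simplest case is the regular \<open>2 * n\<close>-gon, where all \<open>d\<^sub>i\<close> are 1: every point runs outward from
  the center at unit speed, turns around and runs back, and neighbours transpose in the pattern of a
  brick wall. For a general signature the same lines are used, but they are clamped: the \<open>k\<close>-th
  point of a block of size \<open>d\<close> stays between the positions \<open>k\<close> and \<open>n - d + k\<close>, where \<open>k - 1\<close> and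
  \<open>d - k\<close> points of its own block remain inside and outside of it. This deletes from the brick wall
  exactly the transpositions that would exchange two points of one block, those close to the center
  being replaced by the crossing switch.

  In formulas, the blocks are the intervals between consecutive values of a strictly increasing
  \<open>D :: int \<Rightarrow> int\<close> with \<open>D (i + t) = D i + n\<close>, the points are the integers modulo \<open>2 * n\<close>, and \<open>v + n\<close>
  is the conjugate of \<open>v\<close>. The block with cuts \<open>D i\<close> and \<open>D (i + 1)\<close> crosses the center at time
  \<open>D i + D (i + 1)\<close>. The position \<open>pos v \<tau>\<close>, counted from the center and negative on the left, is
  explicit, and three facts about it give everything else.

  Any two points have a time \<open>c\<close> such that their order is constant on \<open>c, \<dots>, c + 2 * n - 1\<close>
  (\<open>ex_below_from\<close>), hence changes exactly at the times congruent to \<open>c\<close>, since positions change sign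
  after \<open>2 * n\<close> moves. This shows that distinct points have distinct positions, and that any two of them
  participate in exactly one switch of a halfperiod, because a switch is precisely what changes the
  order of two points (\<open>obtained_by_switches_order\<close>).

  At a crossing time the points in the central block are reflected (\<open>pos_crossing_reversal\<close>), and every
  other point moves by at most one place without changing sides (\<open>pos_step_outside_crossing\<close>). A
  permutation of positions that moves nothing by more than one place is a product of disjoint adjacent
  transpositions (\<open>obtained_by_switchesI\<close>), so the moves consist of switches as they should.

  Finally some point moves at each time (\<open>particle_moves\<close>), so no move is empty.
\<close>


section \<open>Recognizing the switches of a move\<close>

text \<open>
  The place \<open>e\<close> that \<open>p\<close> vacates can only be filled from one of its neighbours. If it were filled from
  below, then by induction the point filling it would change places with \<open>p\<close>, and \<open>p\<close> would move down.
  The set \<open>U\<close> of places is one that no point enters or leaves.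
\<close>

lemma step_up_forces_step_down:
  fixes f g :: "'a \<Rightarrow> nat"
  assumes f: "bij_betw f P {..<N}" and g: "bij_betw g P {..<N}"
    and U: "\<And>p. p \<in> P \<Longrightarrow> f p \<in> U \<longleftrightarrow> g p \<in> U"
    and small: "\<And>p. p \<in> P \<Longrightarrow> f p \<notin> U \<Longrightarrow> g p \<le> Suc (f p) \<and> f p \<le> Suc (g p)"
    and p: "p \<in> P" "f p = e" "g p = Suc e" "e \<notin> U"
  shows "\<exists>q\<in>P. f q = Suc e \<and> g q = e"
  using p
proof (induction e arbitrary: p rule: less_induct)
  case (less e)
  have "e < N" using less.prems bij_betwE[OF f] by auto
  then obtain r where r: "r \<in> P" "g r = e" using g by (metis bij_betw_iff_bijections lessThan_iff)
  have "f r \<notin> U" using U r less.prems by auto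
  then have "e \<le> Suc (f r)" "f r \<le> Suc e" using small[of r] r by auto
  then consider "f r = Suc e" | "f r = e" | "e = Suc (f r)" by linarith
  then show ?case
  proof cases
    case 2
    then have "r = p" using f less.prems r by (auto simp: bij_betw_def dest: inj_onD)
    then show ?thesis using r less.prems by simp
  next
    case 3
    then obtain q where q: "q \<in> P" "f q = e" "g q = f r" using less.IH[of "f r" r] r \<open>f r \<notin> U\<close> by auto
    then have "q = p" using f less.prems by (auto simp: bij_betw_def dest: inj_onD)
    then show ?thesis using q less.prems 3 by simp
  qed (use r in blast)
qed

text \<open>
  Here \<open>f\<close> and \<open>g\<close> give the indices of the points before and after the move. Besides the prescribed
  switches \<open>C\<close>, the move consists of one transposition for each point that moves up by one place: the
  upper neighbour of such a point moves down into its place.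
\<close>

lemma obtained_by_switchesI:
  fixes f g :: "'a \<Rightarrow> nat"
  assumes f: "bij_betw f P {..<N}" and g: "bij_betw g P {..<N}"
    and xs: "length xs = N" "\<And>p. p \<in> P \<Longrightarrow> xs ! f p = p"
    and ys: "length ys = N" "\<And>p. p \<in> P \<Longrightarrow> ys ! g p = p"
    and C: "\<And>a b. (a, b) \<in> C \<Longrightarrow> a < b \<and> b < N" "disjoint_family_on switch_indices C"
    and rev: "\<And>a b p. (a, b) \<in> C \<Longrightarrow> p \<in> P \<Longrightarrow> a \<le> f p \<Longrightarrow> f p \<le> b \<Longrightarrow> g p = a + b - f p"
    and small: "\<And>p. p \<in> P \<Longrightarrow> f p \<notin> (\<Union>s\<in>C. switch_indices s) \<Longrightarrow> g p \<le> Suc (f p) \<and> f p \<le> Suc (g p)"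
  shows "obtained_by_switches xs ys
    (C \<union> {(f p, g p) | p. p \<in> P \<and> f p \<notin> (\<Union>s\<in>C. switch_indices s) \<and> g p = Suc (f p)})"
    (is "obtained_by_switches xs ys (C \<union> ?A)")
proof -
  define U where "U = (\<Union>s\<in>C. switch_indices s)"
  have U_iff: "k \<in> U \<longleftrightarrow> (\<exists>a b. (a, b) \<in> C \<and> a \<le> k \<and> k \<le> b)" for k
    by (force simp: U_def switch_indices_def)
  have ex_f: "\<exists>p\<in>P. f p = k" and ex_g: "\<exists>p\<in>P. g p = k" if "k < N" for k
    using that f g by (metis bij_betw_iff_bijections lessThan_iff)+
  have inj: "p = q" if "p \<in> P" "q \<in> P" "f p = f q \<or> g p = g q" for p q
    using that f g by (auto simp: bij_betw_def dest: inj_onD)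
  have inv: "f p \<in> U \<longleftrightarrow> g p \<in> U" if p: "p \<in> P" for p
  proof
    assume "f p \<in> U"
    then obtain a b where ab: "(a, b) \<in> C" "a \<le> f p" "f p \<le> b" by (auto simp: U_iff)
    have "g p = a + b - f p" using rev[OF ab(1) p ab(2,3)] .
    then show "g p \<in> U" using ab unfolding U_iff by (intro exI[of _ a] exI[of _ b]) auto
  next
    assume "g p \<in> U"
    then obtain a b where ab: "(a, b) \<in> C" "a \<le> g p" "g p \<le> b" by (auto simp: U_iff)
    have "a + b - g p < N" using ab C(1)[OF ab(1)] by linarith
    then obtain r where r: "r \<in> P" "f r = a + b - g p" using ex_f by blast
    have "g r = a + b - f r" using ab r by (intro rev) auto
    then have "g r = g p" using r ab by simp
    then have "r = p" using inj r p by blast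
    then show "f p \<in> U" using r ab unfolding U_iff by (intro exI[of _ a] exI[of _ b]) auto
  qed
  have down: "\<exists>q\<in>P. f q = Suc (f p) \<and> g q = f p" if "p \<in> P" "f p \<notin> U" "g p = Suc (f p)" for p
    by (rule step_up_forces_step_down[OF f g inv small]) (use that in \<open>auto simp: U_def\<close>)
  have up: "\<exists>q\<in>P. g q = Suc (g p) \<and> f q = g p" if "p \<in> P" "f p \<notin> U" "f p = Suc (g p)" for p
  proof (rule step_up_forces_step_down[OF g f, where U = U])
    show "f q \<le> Suc (g q) \<and> g q \<le> Suc (f q)" if "q \<in> P" "g q \<notin> U" for q
      using that inv small by (auto simp: U_def)
  qed (use that inv inv[OF that(1)] in auto)
  have A: "\<exists>p\<in>P. \<exists>q\<in>P. f p = a \<and> g p = Suc a \<and> f q = Suc a \<and> g q = a \<and> b = Suc a \<and> a \<notin> U \<and> Suc a \<notin> U"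
    if ab: "(a, b) \<in> ?A" for a b
  proof -
    obtain p where "p \<in> P" "(a, b) = (f p, g p)" "f p \<notin> U" "g p = Suc (f p)"
      using ab unfolding U_def by blast
    then have p: "p \<in> P" "f p = a" "g p = Suc a" "b = Suc a" "a \<notin> U" by simp_all
    then obtain q where q: "q \<in> P" "f q = Suc a" "g q = a" using down[of p] by auto
    moreover have "Suc a \<notin> U" using inv[of q] q p by auto
    ultimately show ?thesis using p by blast
  qed
  have f_less: "f p < N" "g p < N" if "p \<in> P" for p using that f g by (auto simp: bij_betw_def)
  show ?thesis unfolding obtained_by_switches_def
  proof (intro conjI)
    show "length ys = length xs" using xs ys by simp
    show "\<forall>(a, b)\<in>C \<union> ?A. a < b \<and> b < length xs"
    proof clarify
      fix a b assume ab: "(a, b) \<in> C \<union> ?A"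
      show "a < b \<and> b < length xs"
      proof (cases "(a, b) \<in> C")
        case False
        then have "(a, b) \<in> ?A" using ab by blast
        then obtain p where "p \<in> P" "g p = Suc a" "b = Suc a" using A[of a b] by blast
        then show ?thesis using f_less(2)[of p] xs by simp
      qed (use C xs in blast)
    qed
    show "disjoint_family_on switch_indices (C \<union> ?A)"
      unfolding disjoint_family_on_def
    proof (intro ballI impI)
      have CA: "switch_indices s \<inter> switch_indices s' = {}" if "s \<in> C" "s' \<in> ?A" for s s'
      proof -
        obtain a b where s': "s' = (a, b)" by (cases s')
        have "a \<notin> U" "Suc a \<notin> U" "b = Suc a" using A[of a b] that s' by auto
        moreover have "k \<notin> switch_indices s" if "k \<notin> U" for k
          using that \<open>s \<in> C\<close> unfolding U_def by blast
        moreover have "switch_indices s' = {a, Suc a}" using s' \<open>b = Suc a\<close> by (auto simp: switch_indices_def)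
        ultimately show ?thesis by simp
      qed
      fix s s' assume s: "s \<in> C \<union> ?A" "s' \<in> C \<union> ?A" "s \<noteq> s'"
      show "switch_indices s \<inter> switch_indices s' = {}"
      proof (cases "s \<in> C \<or> s' \<in> C")
        case True
        then consider "s \<in> C" "s' \<in> C" | "s \<in> C" "s' \<in> ?A" | "s' \<in> C" "s \<in> ?A"
          using s(1,2) by (elim UnE disjE) simp_all
        then show ?thesis
        proof cases
          case 1
          then show ?thesis using C(2) s(3) unfolding disjoint_family_on_def by simp
        next
          case 2
          then show ?thesis by (rule CA)
        next
          case 3
          then show ?thesis unfolding Int_commute[of "switch_indices s"] by (rule CA)
        qed
      next
        case False
        obtain a b c e where ss: "s = (a, b)" "s' = (c, e)" by (cases s, cases s')
        have ab: "(a, b) \<in> ?A" "(c, e) \<in> ?A" using s False ss by auto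
        obtain p q where p: "p \<in> P" "q \<in> P" "f p = a" "g p = Suc a" "f q = Suc a" "g q = a" "b = Suc a"
          using A[OF ab(1)] by blast
        obtain p' q' where q: "p' \<in> P" "q' \<in> P" "f p' = c" "g p' = Suc c" "f q' = Suc c" "g q' = c" "e = Suc c"
          using A[OF ab(2)] by blast
        have "a \<noteq> c" using s ss p q by auto
        moreover have "a \<noteq> Suc c"
        proof
          assume "a = Suc c"
          then have "p = q'" using inj[of p q'] p q by simp
          then show False using p q \<open>a = Suc c\<close> by simp
        qed
        moreover have "c \<noteq> Suc a"
        proof
          assume "c = Suc a"
          then have "p' = q" using inj[of p' q] p q by simp
          then show False using p q \<open>c = Suc a\<close> by simp
        qed
        ultimately show ?thesis using ss p q by (auto simp: switch_indices_def)
      qed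
    qed
    show "\<forall>(a, b)\<in>C \<union> ?A. \<forall>k\<in>{a..b}. ys ! k = xs ! (a + b - k)"
    proof clarify
      fix a b k assume ab: "(a, b) \<in> C \<union> ?A" and k: "k \<in> {a..b}"
      show "ys ! k = xs ! (a + b - k)"
      proof (cases "(a, b) \<in> C")
        case True
        then have "a + b - k < N" using k C(1)[OF True] by auto
        then obtain p where p: "p \<in> P" "f p = a + b - k" using ex_f by blast
        then have "g p = k" using rev[OF True p(1)] k by auto
        then show ?thesis using xs(2)[OF p(1)] ys(2)[OF p(1)] p by simp
      next
        case False
        then have "(a, b) \<in> ?A" using ab by blast
        then obtain p q where p: "p \<in> P" "q \<in> P" "f p = a" "g p = Suc a" "f q = Suc a" "g q = a" "b = Suc a"
          using A[of a b] by blast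
        have "k = a \<or> k = Suc a" using k p by auto
        then show ?thesis using p xs(2)[OF p(1)] xs(2)[OF p(2)] ys(2)[OF p(1)] ys(2)[OF p(2)] by auto
      qed
    qed
    show "\<forall>k<length xs. k \<notin> (\<Union>s\<in>C \<union> ?A. switch_indices s) \<longrightarrow> ys ! k = xs ! k"
    proof (intro allI impI)
      fix k assume k: "k < length xs" "k \<notin> (\<Union>s\<in>C \<union> ?A. switch_indices s)"
      obtain p where p: "p \<in> P" "f p = k" using ex_f k xs by blast
      have pU: "f p \<notin> U" using k p by (auto simp: U_def)
      have "g p \<noteq> Suc (f p)"
      proof
        assume "g p = Suc (f p)"
        then have "(f p, g p) \<in> ?A" using p pU by (auto simp: U_def)
        moreover have "k \<in> switch_indices (f p, g p)" using p \<open>g p = Suc (f p)\<close> by (simp add: switch_indices_def)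
        ultimately show False using k by blast
      qed
      moreover have "f p \<noteq> Suc (g p)"
      proof
        assume fp: "f p = Suc (g p)"
        then obtain q where q: "q \<in> P" "g q = Suc (g p)" "f q = g p" using up p pU by blast
        have "f q \<notin> U" using inv[OF p(1)] pU q(3) by simp
        moreover have "g q = Suc (f q)" using q by simp
        ultimately have "(f q, g q) \<in> ?A" using q(1) unfolding U_def by blast
        moreover have "k \<in> switch_indices (f q, g q)" using p fp q by (simp add: switch_indices_def)
        ultimately show False using k by blast
      qed
      ultimately have "g p = f p" using small[OF p(1)] pU by (auto simp: U_def)
      then show "ys ! k = xs ! k" using xs(2)[OF p(1)] ys(2)[OF p(1)] p by simp
    qed
  qed
qed

text \<open>
  Since the entries are distinct, the index of an entry after the move is determined by the switch
  that contains it.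
\<close>

lemma obtained_by_switches_index:
  assumes S: "obtained_by_switches xs ys S" and d: "distinct ys"
    and i: "i < length xs" "i' < length xs" "ys ! i' = xs ! i"
  obtains (switched) a b where "(a, b) \<in> S" "a \<le> i" "i \<le> b" "i' = a + b - i"
  | (fixed) "i' = i" "\<And>a b. (a, b) \<in> S \<Longrightarrow> i < a \<or> b < i"
proof (cases "\<exists>a b. (a, b) \<in> S \<and> a \<le> i \<and> i \<le> b")
  case True
  then obtain a b where ab: "(a, b) \<in> S" "a \<le> i" "i \<le> b" by blast
  have l: "a < b" "b < length xs" using obtained_by_switchesD[OF S ab(1)] by blast+
  have "ys ! (a + b - i) = xs ! i" using obtained_by_switchesD(3)[OF S ab(1), of "a + b - i"] ab by simp
  moreover have "a + b - i < length ys" "i' < length ys" using ab l i S by (auto simp: obtained_by_switches_def)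
  ultimately have "i' = a + b - i" using d i(3) by (metis nth_eq_iff_index_eq)
  then show thesis using switched ab by blast
next
  case False
  have "ys ! i = xs ! i" using False i obtained_by_switches_moved[OF S i(1)] by metis
  moreover have "i < length ys" "i' < length ys" using i S by (auto simp: obtained_by_switches_def)
  ultimately have "i' = i" using d i(3) by (metis nth_eq_iff_index_eq)
  then show thesis
  proof (rule fixed)
    show "i < a \<or> b < i" if "(a, b) \<in> S" for a b using False that not_le by blast
  qed
qed

text \<open>
  A switch reverses the order of its entries. Entries that share no switch keep theirs, since each of
  them stays within an interval that is disjoint from, and hence on one side of, that of the other.
\<close>

lemma obtained_by_switches_order:
  assumes S: "obtained_by_switches xs ys S" and d: "distinct ys"
    and i: "i < length xs" "i' < length xs" "ys ! i' = xs ! i"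
    and j: "j < length xs" "j' < length xs" "ys ! j' = xs ! j"
    and ij: "i < j"
  shows "(\<exists>s\<in>S. i \<in> switch_indices s \<and> j \<in> switch_indices s) \<longleftrightarrow> j' < i'"
proof -
  have *: "(\<exists>s\<in>S. i \<in> switch_indices s \<and> j \<in> switch_indices s) \<longleftrightarrow>
      (\<exists>a b. (a, b) \<in> S \<and> a \<le> i \<and> i \<le> b \<and> a \<le> j \<and> j \<le> b)"
    by (force simp: switch_indices_def)
  have disj: "(a, b) = (c, e) \<or> b < c \<or> e < a" if "(a, b) \<in> S" "(c, e) \<in> S" for a b c e
  proof (rule ccontr)
    assume no: "\<not> ?thesis"
    then have "switch_indices (a, b) \<inter> switch_indices (c, e) = {}"
      using S that unfolding obtained_by_switches_def disjoint_family_on_def by blast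
    moreover have "max a c \<in> switch_indices (a, b) \<inter> switch_indices (c, e)"
      using no obtained_by_switchesD(1)[OF S that(1)] obtained_by_switchesD(1)[OF S that(2)]
      by (auto simp: switch_indices_def)
    ultimately show False by blast
  qed
  show ?thesis unfolding *
    using S d i
  proof (cases rule: obtained_by_switches_index)
    case (switched a b)
    note ab = switched
    show "(\<exists>a b. (a, b) \<in> S \<and> a \<le> i \<and> i \<le> b \<and> a \<le> j \<and> j \<le> b) \<longleftrightarrow> j' < i'"
      using S d j
    proof (cases rule: obtained_by_switches_index)
      case (switched c e)
      show ?thesis
      proof (cases "(a, b) = (c, e)")
        case True
        then have "j' < i'" using ab switched ij by auto
        moreover have "a \<le> j" "j \<le> b" using True switched by auto
        ultimately show ?thesis using ab by blast
      next
        case False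
        then have "b < c" using disj[OF ab(1) switched(1)] ab switched ij by auto
        moreover have "\<not> (\<exists>a b. (a, b) \<in> S \<and> a \<le> i \<and> i \<le> b \<and> a \<le> j \<and> j \<le> b)"
        proof
          assume "\<exists>a b. (a, b) \<in> S \<and> a \<le> i \<and> i \<le> b \<and> a \<le> j \<and> j \<le> b"
          then obtain x y where x: "(x, y) \<in> S" "x \<le> i" "i \<le> y" "x \<le> j" "j \<le> y" by blast
          then have "(x, y) = (a, b)" "(x, y) = (c, e)"
            using disj[OF x(1) ab(1)] disj[OF x(1) switched(1)] ab switched by auto
          then show False using False by simp
        qed
        ultimately show ?thesis using ab switched by auto
      qed
    next
      case fixed
      have "b < j" using fixed(2)[OF ab(1)] ab ij by auto
      then show ?thesis using fixed ab by force
    qed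
  next
    case fixed
    note fi = fixed
    show "(\<exists>a b. (a, b) \<in> S \<and> a \<le> i \<and> i \<le> b \<and> a \<le> j \<and> j \<le> b) \<longleftrightarrow> j' < i'"
      using S d j
    proof (cases rule: obtained_by_switches_index)
      case (switched c e)
      have "i < c" using fi(2)[OF switched(1)] switched ij by auto
      then show ?thesis using fi switched by force
    next
      case fixed
      then show ?thesis using fi ij by force
    qed
  qed
qed

text \<open>
  Something that changes at every multiple of \<open>M\<close> is in a state given by the parity of a quotient by
  \<open>M\<close>; the order of two points will be of this kind, with \<open>M = 2 * n\<close>.
\<close>

lemma parity_of_quotient_changes_iff:
  fixes z M :: int
  assumes "M > 1"
  shows "even (z div M) \<noteq> even ((z - 1) div M) \<longleftrightarrow> M dvd z"
proof -
  define q where "q = z div M"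
  define r where "r = z mod M"
  have z: "z = r + M * q" "0 \<le> r" "r < M" using assms by (simp_all add: q_def r_def)
  have d: "M dvd z \<longleftrightarrow> r = 0" by (simp add: r_def dvd_eq_mod_eq_0)
  show ?thesis
  proof (cases "r = 0")
    case True
    have "z - 1 = (M - 1) + M * (q - 1)" using True z(1) by (simp add: algebra_simps)
    moreover have "((M - 1) + M * (q - 1)) div M = q - 1" using assms by simp
    ultimately have "(z - 1) div M = q - 1" by metis
    then show ?thesis using True d by (simp add: q_def[symmetric])
  next
    case False
    have "z - 1 = (r - 1) + M * q" using z(1) by simp
    moreover have "((r - 1) + M * q) div M = q" using assms z False by simp
    ultimately have "(z - 1) div M = q" by metis
    then show ?thesis using False d by (simp add: q_def[symmetric])
  qed
qed

section \<open>Trajectories of the points\<close>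

text \<open>
  The blocks are the intervals \<open>D i < v \<le> D (i + 1)\<close>, of which \<open>t\<close> consecutive ones cross the center
  during a halfperiod. Indexing them by all integers makes conjugation, \<open>v \<mapsto> v + n\<close>, and the
  passage of time shifts of the index.
\<close>

locale block_cuts =
  fixes D :: "int \<Rightarrow> int" and t n :: int
  assumes two_blocks: "t > 1"
    and D_strict_mono: "strict_mono D"
    and D_shift: "D (i + t) = D i + n"
begin

lemma D_less_iff: "D i < D j \<longleftrightarrow> i < j"
  using D_strict_mono by (rule strict_mono_less)

lemma D_le_iff: "D i \<le> D j \<longleftrightarrow> i \<le> j"
  using D_strict_mono by (rule strict_mono_less_eq)

lemma n_gt_1: "n > 1"
proof -
  have "D 0 < D 1" "D 1 < D t" using two_blocks by (auto simp: D_less_iff)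
  then show ?thesis using D_shift[of 0] by simp
qed

lemma D_add_nat: "D i + int j \<le> D (i + int j)"
proof (induction j)
  case (Suc j)
  have "D (i + int j) < D (i + int (Suc j))" by (simp add: D_less_iff)
  then show ?case using Suc by simp
qed simp

text \<open>
  The least cut that is not below \<open>v\<close> exists since \<open>D\<close> grows at least as fast as the identity.
\<close>

lemma ex1_block: "\<exists>!i. D i < v \<and> v \<le> D (i + 1)"
proof -
  \<comment> \<open>Far enough to the left for \<open>D m < v\<close>.\<close>
  define m where "m = - int (nat (D 0 - v + 1))"
  have "D m + int (nat (D 0 - v + 1)) \<le> D 0"
    using D_add_nat[of m "nat (D 0 - v + 1)"] by (simp add: m_def)
  then have m: "D m < v" by linarith
  have "D m + int (nat (v - D m)) \<le> D (m + int (nat (v - D m)))" by (rule D_add_nat)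
  then have ex: "v \<le> D (m + int (nat (v - D m)))" by linarith
  define j where "j = (LEAST j. v \<le> D (m + int j))"
  have j: "v \<le> D (m + int j)" unfolding j_def using ex by (rule LeastI)
  then have "j \<noteq> 0" using m by (intro notI) simp
  then obtain k where k: "j = Suc k" using not0_implies_Suc by blast
  have "\<not> v \<le> D (m + int k)" using k not_less_Least[of k "\<lambda>j. v \<le> D (m + int j)"]
    unfolding j_def by simp
  then have "D (m + int k) < v \<and> v \<le> D (m + int k + 1)" using j k by (simp add: ac_simps)
  moreover have "i = i'" if "D i < v \<and> v \<le> D (i + 1)" "D i' < v \<and> v \<le> D (i' + 1)" for i i'
  proof -
    have "D i < D (i' + 1)" "D i' < D (i + 1)" using that by linarith+
    then show ?thesis by (simp add: D_less_iff)
  qed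
  ultimately show ?thesis by blast
qed

definition block :: "int \<Rightarrow> int" where
  "block v = (THE i. D i < v \<and> v \<le> D (i + 1))"

definition lo :: "int \<Rightarrow> int" where "lo v = D (block v)"

definition hi :: "int \<Rightarrow> int" where "hi v = D (block v + 1)"

lemma lo_less: "lo v < v" and le_hi: "v \<le> hi v"
  using theI'[OF ex1_block[of v]] unfolding lo_def hi_def block_def by blast+

lemma block_eqI: "D i < v \<Longrightarrow> v \<le> D (i + 1) \<Longrightarrow> block v = i"
  unfolding block_def using ex1_block[of v] by (intro the1_equality) auto

lemma block_shift: "block (v + n) = block v + t"
proof (rule block_eqI)
  show "D (block v + t) < v + n" using lo_less[of v] by (simp add: D_shift lo_def)
  have "D (block v + t + 1) = D (block v + 1) + n" using D_shift[of "block v + 1"] by (simp add: ac_simps)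
  then show "v + n \<le> D (block v + t + 1)" using le_hi[of v] by (simp add: hi_def)
qed

lemma lo_shift: "lo (v + n) = lo v + n"
  by (simp add: lo_def block_shift D_shift)

lemma hi_shift: "hi (v + n) = hi v + n"
  unfolding hi_def block_shift using D_shift[of "block v + 1"] by (simp add: ac_simps)

lemma block_mono: "v \<le> w \<Longrightarrow> block v \<le> block w"
proof -
  assume "v \<le> w"
  then have "D (block v) < D (block w + 1)" using lo_less[of v] le_hi[of w] by (simp add: lo_def hi_def)
  then show ?thesis by (simp add: D_less_iff)
qed

lemma block_width: "hi v - lo v < n"
proof -
  have "hi v < lo v + n" unfolding hi_def lo_def
    using D_shift[of "block v"] D_less_iff[of "block v + 1" "block v + t"] two_blocks by simp
  then show ?thesis by simp
qed

lemma hi_le_lo: "block v < block w \<Longrightarrow> hi v \<le> lo w"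
  by (simp add: hi_def lo_def D_le_iff)

lemma hi_le_lo_shift: "block w < block v + t \<Longrightarrow> hi w \<le> lo v + n"
  using hi_le_lo[of w "v + n"] by (simp add: block_shift lo_shift)

definition crossing_time :: "int \<Rightarrow> int" where "crossing_time v = lo v + hi v"

text \<open>
  The distance from the center at \<open>s\<close> moves after the crossing time, for \<open>0 \<le> s < 2 * n\<close>. With
  \<open>k = v - lo v\<close> and \<open>d = hi v - lo v\<close> it is \<open>2 * k - d + s\<close> on the way out and \<open>2 * k - d + (2 * n - 1 - s)\<close>
  on the way back, clamped to the range from \<open>k\<close> to \<open>n - d + k\<close>.
\<close>

definition height :: "int \<Rightarrow> int \<Rightarrow> int" where
  "height v s = max (v - lo v)
     (min (n - hi v + v) (2 * v - lo v - hi v + min s (2 * n - 1 - s)))"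

text \<open>
  Successive excursions, each of length \<open>2 * n\<close>, lie alternately to the right and to the left of the
  center.
\<close>

definition pos :: "int \<Rightarrow> int \<Rightarrow> int" where
  "pos v \<tau> = (if even ((\<tau> - crossing_time v) div (2 * n)) then 1 else - 1) *
     height v ((\<tau> - crossing_time v) mod (2 * n))"

lemma pos_eq_height:
  "crossing_time v \<le> \<tau> \<Longrightarrow> \<tau> < crossing_time v + 2 * n \<Longrightarrow> pos v \<tau> = height v (\<tau> - crossing_time v)"
  by (simp add: pos_def)

lemma pos_add_period: "pos v (\<tau> + 2 * n) = - pos v \<tau>"
proof -
  have "\<tau> + 2 * n - crossing_time v = (\<tau> - crossing_time v) + 2 * n" by simp
  then show ?thesis using n_gt_1 unfolding pos_def by (simp only: div_add_self2 mod_add_self2) simp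
qed

lemma pos_diff_period: "pos v (\<tau> - 2 * n) = - pos v \<tau>"
  using pos_add_period[of v "\<tau> - 2 * n"] by simp

lemma height_shift: "height (v + n) s = height v s"
  unfolding height_def lo_shift hi_shift by (simp add: algebra_simps)

lemma pos_conjugate: "pos (v + n) \<tau> = - pos v \<tau>"
proof -
  have "crossing_time (v + n) = crossing_time v + 2 * n"
    by (simp add: crossing_time_def lo_shift hi_shift)
  then have "pos (v + n) (\<tau> + 2 * n) = pos v \<tau>"
    unfolding pos_def height_shift by simp
  then show ?thesis by (simp add: pos_add_period)
qed

lemma pos_double_shift: "pos (v + 2 * n) \<tau> = pos v \<tau>"
  using pos_conjugate[of "v + n" \<tau>] pos_conjugate[of v \<tau>] by (simp add: ac_simps)

lemma height_bounds: "0 < height v s" "height v s \<le> n"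
  using lo_less[of v] le_hi[of v] block_width[of v] by (auto simp: height_def)

lemma pos_bounds: "pos v \<tau> \<noteq> 0" "\<bar>pos v \<tau>\<bar> \<le> n"
proof -
  have "\<bar>pos v \<tau>\<bar> = height v ((\<tau> - crossing_time v) mod (2 * n))"
    using height_bounds(1) by (simp add: pos_def abs_mult less_imp_le)
  then show "pos v \<tau> \<noteq> 0" "\<bar>pos v \<tau>\<bar> \<le> n"
    using height_bounds[of v "(\<tau> - crossing_time v) mod (2 * n)"] by linarith+
qed

text \<open>
  Used to move a time, or a point, into a window of length \<open>2 * n\<close> in which formulas are explicit.
\<close>

lemma principal_period: "\<exists>m. c \<le> \<tau> + 2 * n * m \<and> \<tau> + 2 * n * m < c + 2 * n"
proof -
  have "\<tau> - 2 * n * ((\<tau> - c) div (2 * n)) = c + (\<tau> - c) mod (2 * n)"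
    by (simp add: minus_mult_div_eq_mod [symmetric])
  moreover have "0 \<le> (\<tau> - c) mod (2 * n)" "(\<tau> - c) mod (2 * n) < 2 * n" using n_gt_1 by simp_all
  ultimately show ?thesis by (intro exI[of _ "- ((\<tau> - c) div (2 * n))"]) simp
qed

lemma pos_shift_mult: "pos v (\<tau> + 2 * n * m) = (if even m then 1 else - 1) * pos v \<tau>"
proof -
  have "\<tau> + 2 * n * m - crossing_time v = (\<tau> - crossing_time v) + m * (2 * n)" by simp
  then show ?thesis using n_gt_1 unfolding pos_def by (simp only: div_mult_self1 mod_mult_self1) simp
qed

definition below_from :: "int \<Rightarrow> int \<Rightarrow> int \<Rightarrow> bool" where
  "below_from v w c \<longleftrightarrow> (\<forall>\<tau>. c \<le> \<tau> \<and> \<tau> < c + 2 * n \<longrightarrow> pos v \<tau> < pos w \<tau>)"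

lemma below_from_swap: "below_from v w c \<Longrightarrow> below_from w v (c + 2 * n)"
  unfolding below_from_def
proof (intro allI impI)
  fix \<tau> assume "\<forall>\<tau>. c \<le> \<tau> \<and> \<tau> < c + 2 * n \<longrightarrow> pos v \<tau> < pos w \<tau>" "c + 2 * n \<le> \<tau> \<and> \<tau> < c + 2 * n + 2 * n"
  then have "pos v (\<tau> - 2 * n) < pos w (\<tau> - 2 * n)" by auto
  then show "pos w \<tau> < pos v \<tau>" by (simp add: pos_diff_period)
qed

text \<open>
  Within a block the order from the center outward never changes, so the order on the line changes
  exactly when the block crosses the center.
\<close>

lemma below_same_block:
  assumes "v < w" "block v = block w"
  shows "below_from v w (crossing_time v)"
  using assms by (auto simp: below_from_def pos_eq_height crossing_time_def lo_def hi_def height_def)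

text \<open>
  Between two crossings, a block and its conjugate are on opposite sides of the center.
\<close>

lemma below_opposite_block:
  assumes "block w = block v + t"
  shows "below_from w v (crossing_time v)"
proof -
  define w0 where "w0 = w - n"
  have w: "w = w0 + n" by (simp add: w0_def)
  have "block w0 = block v" using assms by (simp add: w block_shift)
  then have T: "crossing_time w0 = crossing_time v" by (simp add: crossing_time_def lo_def hi_def)
  show ?thesis unfolding below_from_def w pos_conjugate
  proof (intro allI impI)
    fix \<tau> assume "crossing_time v \<le> \<tau> \<and> \<tau> < crossing_time v + 2 * n"
    then have "pos w0 \<tau> > 0" "pos v \<tau> > 0" by (simp_all add: pos_eq_height T height_bounds)
    then show "- pos w0 \<tau> < pos v \<tau>" by simp
  qed
qed

text \<open>
  The two points cross the center at different times, say \<open>v\<close> first. In between they are on opposite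
  sides. While both are on the right, the line \<open>\<tau> - 2 * (lo w + hi w - w)\<close> on which \<open>w\<close> goes out meets
  the line \<open>2 * (v + n) - 1 - \<tau>\<close> on which \<open>v\<close> comes back just before the time
  \<open>(lo w + hi w - w) + v + n\<close>, at a position to which neither of them is confined by its clamps. That
  time minus \<open>2 * n\<close> is the start of the window.
\<close>

lemma below_different_blocks:
  assumes "block v < block w" "block w < block v + t"
  shows "below_from w v (lo w + hi w - w + v - n)"
  unfolding below_from_def
proof (intro allI impI)
  have F: "lo v < v" "v \<le> hi v" "hi v \<le> lo w" "lo w < w" "w \<le> hi w" "hi w \<le> lo v + n"
    using lo_less le_hi hi_le_lo[OF assms(1)] hi_le_lo_shift[OF assms(2)] by auto
  fix \<tau> assume tau: "lo w + hi w - w + v - n \<le> \<tau> \<and> \<tau> < lo w + hi w - w + v - n + 2 * n"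
  consider "\<tau> < crossing_time v" | "crossing_time v \<le> \<tau>" "\<tau> < crossing_time w" | "crossing_time w \<le> \<tau>"
    by linarith
  then show "pos w \<tau> < pos v \<tau>"
  proof cases
    case 1
    then have "pos v (\<tau> + 2 * n) = height v (\<tau> + 2 * n - crossing_time v)"
        "pos w (\<tau> + 2 * n) = height w (\<tau> + 2 * n - crossing_time w)"
      using tau F unfolding crossing_time_def by (auto intro!: pos_eq_height[unfolded crossing_time_def])
    moreover have "height v (\<tau> + 2 * n - crossing_time v) < height w (\<tau> + 2 * n - crossing_time w)"
      using tau F 1 unfolding height_def crossing_time_def by linarith
    ultimately show ?thesis by (simp add: pos_add_period)
  next
    case 2
    have "pos v \<tau> > 0" using 2 F by (subst pos_eq_height) (auto simp: crossing_time_def height_bounds)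
    moreover have "pos w (\<tau> + 2 * n) > 0"
      using 2 F by (subst pos_eq_height) (auto simp: crossing_time_def height_bounds)
    ultimately show ?thesis by (simp add: pos_add_period)
  next
    case 3
    then have "pos v \<tau> = height v (\<tau> - crossing_time v)"
        "pos w \<tau> = height w (\<tau> - crossing_time w)"
      using tau F unfolding crossing_time_def by (auto intro!: pos_eq_height[unfolded crossing_time_def])
    moreover have "height w (\<tau> - crossing_time w) < height v (\<tau> - crossing_time v)"
      using tau F 3 unfolding height_def crossing_time_def by linarith
    ultimately show ?thesis by simp
  qed
qed

text \<open>
  Exchanging the roles of \<open>v\<close> and \<open>w\<close>, if \<open>w\<close> is more than half a turn ahead of \<open>v\<close>, leaves the three
  relative positions of blocks treated above.
\<close>

lemma ex_below_from:
  assumes "v < w" "w < v + 2 * n"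
  shows "\<exists>c. below_from v w c"
proof -
  have *: "\<exists>c. below_from v w c \<or> below_from w v c" if vw: "v < w" "w \<le> v + n" for v w
  proof -
    have "block v \<le> block w" "block w \<le> block v + t"
      using vw block_mono[of v w] block_mono[of w "v + n"] by (simp_all add: block_shift)
    then consider "block v = block w" | "block w = block v + t" | "block v < block w" "block w < block v + t"
      by linarith
    then show ?thesis
      by cases (use vw below_same_block below_opposite_block below_different_blocks in blast)+
  qed
  have "\<exists>c. below_from v w c \<or> below_from w v c"
  proof (cases "w \<le> v + n")
    case False
    then have "\<exists>c. below_from w (v + 2 * n) c \<or> below_from (v + 2 * n) w c" using assms by (intro *) auto
    then show ?thesis by (auto simp: below_from_def pos_double_shift)
  qed (use * assms in blast)
  then show ?thesis using below_from_swap by blast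
qed

lemma pos_step:
  assumes "\<not> (\<exists>m. \<tau> = crossing_time v + 2 * n * m)"
  shows "sgn (pos v \<tau>) = sgn (pos v (\<tau> - 1))" "\<bar>pos v \<tau> - pos v (\<tau> - 1)\<bar> \<le> 1"
proof -
  obtain m where m: "crossing_time v \<le> \<tau> + 2 * n * m" "\<tau> + 2 * n * m < crossing_time v + 2 * n"
    using principal_period by blast
  define \<tau>' where "\<tau>' = \<tau> + 2 * n * m"
  have "\<tau>' \<noteq> crossing_time v"
  proof
    assume "\<tau>' = crossing_time v"
    then have "\<tau> = crossing_time v + 2 * n * (- m)" by (simp add: \<tau>'_def)
    then show False using assms by blast
  qed
  then have eq: "pos v \<tau>' = height v (\<tau>' - crossing_time v)"
      "pos v (\<tau>' - 1) = height v (\<tau>' - 1 - crossing_time v)"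
    using m by (auto simp: \<tau>'_def intro!: pos_eq_height)
  have S: "sgn (pos v \<tau>') = sgn (pos v (\<tau>' - 1))" by (simp add: eq height_bounds)
  have A: "\<bar>pos v \<tau>' - pos v (\<tau>' - 1)\<bar> \<le> 1" unfolding eq height_def by linarith
  have "\<tau>' - 1 = (\<tau> - 1) + 2 * n * m" by (simp add: \<tau>'_def)
  then have E: "pos v \<tau>' = (if even m then 1 else - 1) * pos v \<tau>"
      "pos v (\<tau>' - 1) = (if even m then 1 else - 1) * pos v (\<tau> - 1)"
    unfolding \<tau>'_def by (simp_all only: pos_shift_mult)
  show "sgn (pos v \<tau>) = sgn (pos v (\<tau> - 1))" using S unfolding E by (auto split: if_splits)
  show "\<bar>pos v \<tau> - pos v (\<tau> - 1)\<bar> \<le> 1" using A unfolding E by (auto split: if_splits)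
qed

lemma pos_at_crossing: "pos v (crossing_time v) = v - lo v" "pos v (crossing_time v - 1) = - (v - lo v)"
proof -
  have F: "lo v < v" "v \<le> hi v" "hi v - lo v < n" using lo_less le_hi block_width by auto
  then show "pos v (crossing_time v) = v - lo v"
    by (subst pos_eq_height) (auto simp: height_def)
  have "pos v (crossing_time v - 1 + 2 * n) = v - lo v" using F
    by (subst pos_eq_height) (auto simp: height_def)
  then show "pos v (crossing_time v - 1) = - (v - lo v)" by (simp add: pos_add_period)
qed


lemma D_shift_mult: "D (i + t * m) = D i + n * m"
proof (induction m rule: int_induct[where k = 0])
  case (step1 m)
  then show ?case using D_shift[of "i + t * m"] by (simp add: algebra_simps)
next
  case (step2 m)
  then show ?case using D_shift[of "i + t * (m - 1)"] by (simp add: algebra_simps)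
qed simp

definition cross :: "int \<Rightarrow> int" where "cross i = D i + D (i + 1)"

lemma crossing_time_block: "crossing_time v = cross (block v)"
  by (simp add: crossing_time_def cross_def lo_def hi_def)

lemma cross_strict_mono: "strict_mono cross"
  by (auto simp: strict_mono_def cross_def D_less_iff intro!: add_strict_mono)

lemma cross_shift: "cross (i + t) = cross i + 2 * n"
  using D_shift[of i] D_shift[of "i + 1"] by (simp add: cross_def ac_simps)

text \<open>
  Between consecutive crossing times the block of the former leaves the center through the block of
  the latter, and at each move some outgoing point of the one meets an incoming point of the other.
\<close>

lemma particle_moves: "\<exists>v. pos v \<tau> \<noteq> pos v (\<tau> - 1)"
proof -
  interpret C: block_cuts cross t "2 * n"
    using two_blocks cross_strict_mono cross_shift by unfold_locales
  obtain i where "cross i < \<tau> + 1" "\<tau> + 1 \<le> cross (i + 1)"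
    using C.ex1_block[of "\<tau> + 1"] by blast
  then have i: "D i + D (i + 1) \<le> \<tau>" "\<tau> < D (i + 1) + D (i + 2)"
    by (simp_all add: cross_def ac_simps)
  have D: "D i < D (i + 1)" "D (i + 1) < D (i + 2)" "D (i + 2) \<le> D i + n"
    using two_blocks D_le_iff[of "i + 2" "i + t"] by (auto simp: D_less_iff D_shift)
  have B: "lo v = D i \<and> hi v = D (i + 1)" if "D i < v" "v \<le> D (i + 1)" for v
    using block_eqI[OF that] by (simp add: lo_def hi_def)
  show ?thesis
  proof (cases "\<tau> = D i + D (i + 1)")
    case True
    then have "\<tau> = crossing_time (D (i + 1))" using B D by (simp add: crossing_time_def)
    then show ?thesis using pos_at_crossing[of "D (i + 1)"] lo_less[of "D (i + 1)"]
      by (intro exI[of _ "D (i + 1)"]) simp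
  next
    case False
    \<comment> \<open>The outgoing line \<open>u\<close> meets at time \<open>\<tau>\<close> the incoming line \<open>\<tau> - u\<close>,
      which belongs to the next block.\<close>
    define u where "u = max (D i) (\<tau> - D (i + 2))"
    \<comment> \<open>The point of the block that goes out on the line \<open>\<tau> - 2 * u\<close>.\<close>
    define w where "w = D i + D (i + 1) - u"
    have w: "D i < w" "w \<le> D (i + 1)" using i D by (auto simp: w_def u_def)
    have T: "crossing_time w = D i + D (i + 1)" using B[OF w] by (simp add: crossing_time_def)
    have "pos w \<tau> = height w (\<tau> - crossing_time w)"
        "pos w (\<tau> - 1) = height w (\<tau> - 1 - crossing_time w)"
      using i D False by (simp_all add: pos_eq_height T)
    moreover have "height w (\<tau> - crossing_time w) \<noteq> height w (\<tau> - 1 - crossing_time w)"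
      unfolding height_def T conjunct1[OF B[OF w]] conjunct2[OF B[OF w]]
      using i D False w unfolding w_def u_def by (simp add: max_def min_def split: if_splits)
    ultimately show ?thesis by metis
  qed
qed

lemma pos_shift_mult_point: "pos (v + 2 * n * m) \<tau> = pos v \<tau>"
proof (induction m rule: int_induct[where k = 0])
  case (step1 m)
  then show ?case using pos_double_shift[of "v + 2 * n * m" \<tau>] by (simp add: algebra_simps)
next
  case (step2 m)
  then show ?case using pos_double_shift[of "v + 2 * n * (m - 1)" \<tau>] by (simp add: algebra_simps)
qed simp

text \<open>
  Distinct points never meet, because at every time one of them is strictly below the other.
\<close>

lemma pos_eqD:
  assumes "pos v \<tau> = pos w \<tau>"
  shows "\<exists>m. v = w + 2 * n * m"
proof (rule ccontr)
  assume no: "\<nexists>m. v = w + 2 * n * m"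
  obtain m where m: "v \<le> w + 2 * n * m" "w + 2 * n * m < v + 2 * n" using principal_period by blast
  define w' where "w' = w + 2 * n * m"
  have "v \<noteq> w'" using no by (auto simp: w'_def)
  then obtain c where c: "below_from v w' c" using m ex_below_from[of v w'] by (auto simp: w'_def)
  obtain l where l: "c \<le> \<tau> + 2 * n * l" "\<tau> + 2 * n * l < c + 2 * n" using principal_period by blast
  have "pos v (\<tau> + 2 * n * l) \<noteq> pos w' (\<tau> + 2 * n * l)" using c l unfolding below_from_def by fastforce
  then have "pos v \<tau> \<noteq> pos w' \<tau>" unfolding pos_shift_mult by auto
  then show False using assms by (simp add: w'_def pos_shift_mult_point)
qed

text \<open>
  The points of the crossing block and their conjugates occupy all central positions just before the
  crossing; by injectivity no other point can be there.
\<close>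

lemma pos_crossing_reversal:
  assumes "\<bar>pos v (cross i - 1)\<bar> \<le> D (i + 1) - D i"
  shows "pos v (cross i) = - pos v (cross i - 1)"
proof -
  define x where "x = \<bar>pos v (cross i - 1)\<bar>"
  define w where "w = D i + x"
  have x: "0 < x" "x \<le> D (i + 1) - D i" using pos_bounds(1)[of v "cross i - 1"] assms by (auto simp: x_def)
  then have "block w = i" by (intro block_eqI) (auto simp: w_def)
  then have T: "crossing_time w = cross i" "lo w = D i" by (simp_all add: crossing_time_block lo_def)
  have w: "pos w (cross i) = x" "pos w (cross i - 1) = - x"
    using pos_at_crossing[of w] unfolding T by (simp_all add: w_def)
  show ?thesis
  proof (cases "pos v (cross i - 1) < 0")
    case True
    then have "pos v (cross i - 1) = pos w (cross i - 1)" using w by (simp add: x_def)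
    then obtain m where "v = w + 2 * n * m" using pos_eqD by blast
    then show ?thesis by (simp add: pos_shift_mult_point w)
  next
    case False
    then have "pos v (cross i - 1) = pos (w + n) (cross i - 1)" using w by (simp add: x_def pos_conjugate)
    then obtain m where "v = w + n + 2 * n * m" using pos_eqD by blast
    then show ?thesis using w by (simp add: pos_shift_mult_point pos_conjugate)
  qed
qed

text \<open>
  Trajectories are continuous except for the jump of a point across the center with its own block, and
  then the point is within the central positions reversed by that crossing.
\<close>

lemma pos_step_outside_crossing:
  assumes "\<And>i. \<tau> = cross i \<Longrightarrow> D (i + 1) - D i < \<bar>pos v (\<tau> - 1)\<bar>"
  shows "sgn (pos v \<tau>) = sgn (pos v (\<tau> - 1))" "\<bar>pos v \<tau> - pos v (\<tau> - 1)\<bar> \<le> 1"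
proof -
  have "\<not> (\<exists>m. \<tau> = crossing_time v + 2 * n * m)"
  proof
    assume "\<exists>m. \<tau> = crossing_time v + 2 * n * m"
    then obtain m where m: "\<tau> = crossing_time v + 2 * n * m" by blast
    define i where "i = block v + t * m"
    have D: "D i = lo v + n * m" "D (i + 1) = hi v + n * m"
      using D_shift_mult[of "block v" m] D_shift_mult[of "block v + 1" m]
      by (simp_all add: i_def lo_def hi_def ac_simps)
    have "\<tau> = cross i" using D by (simp add: m cross_def crossing_time_def)
    moreover have "\<tau> - 1 = (crossing_time v - 1) + 2 * n * m" by (simp add: m)
    then have "\<bar>pos v (\<tau> - 1)\<bar> = v - lo v"
      using lo_less[of v] by (simp only: pos_shift_mult pos_at_crossing) (auto simp: abs_mult)
    ultimately show False using assms[of i] D le_hi[of v] by simp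
  qed
  then show "sgn (pos v \<tau>) = sgn (pos v (\<tau> - 1))" "\<bar>pos v \<tau> - pos v (\<tau> - 1)\<bar> \<le> 1"
    by (rule pos_step)+
qed

lemma order_iff_even:
  assumes "below_from v w c"
  shows "pos v \<tau> < pos w \<tau> \<longleftrightarrow> even ((\<tau> - c) div (2 * n))"
proof -
  define q where "q = (\<tau> - c) div (2 * n)"
  define r where "r = (\<tau> - c) mod (2 * n)"
  have r: "0 \<le> r" "r < 2 * n" using n_gt_1 by (simp_all add: r_def)
  have "\<tau> = (c + r) + 2 * n * q" using mult_div_mod_eq[of "2 * n" "\<tau> - c"] unfolding q_def r_def by linarith
  moreover have "pos v (c + r) < pos w (c + r)" using assms r by (simp add: below_from_def)
  ultimately show ?thesis unfolding q_def[symmetric] by (simp add: pos_shift_mult)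
qed

section \<open>The allowable sequence of a family of cuts\<close>

definition points :: "nat set" where "points = {1..nat (2 * n)}"

text \<open>
  The 0-based index in a list of length \<open>2 * n\<close>; the position 0 does not occur, so the positive
  positions are shifted by one less than the negative ones.
\<close>

definition idx :: "nat \<Rightarrow> int \<Rightarrow> nat" where
  "idx p \<tau> = nat (if pos (int p) \<tau> > 0 then n - 1 + pos (int p) \<tau> else n + pos (int p) \<tau>)"

definition seq :: "int \<Rightarrow> nat list" where
  "seq \<tau> = map (inv_into points (\<lambda>p. idx p \<tau>)) [0..<nat (2 * n)]"

text \<open>
  Empty or a singleton: the centered substring with \<open>D (i + 1) - D i\<close> entries on each side.
\<close>

definition crossings :: "int \<Rightarrow> switch set" where
  "crossings \<tau> = {(nat (n - (D (i + 1) - D i)), nat (n + (D (i + 1) - D i) - 1)) | i. \<tau> = cross i}"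

lemma int_idx: "int (idx p \<tau>) = (if pos (int p) \<tau> > 0 then n - 1 + pos (int p) \<tau> else n + pos (int p) \<tau>)"
  using pos_bounds[of "int p" \<tau>] by (auto simp: idx_def)

lemma idx_less_iff: "idx p \<tau> < idx q \<tau>' \<longleftrightarrow> pos (int p) \<tau> < pos (int q) \<tau>'"
proof -
  have "idx p \<tau> < idx q \<tau>' \<longleftrightarrow> int (idx p \<tau>) < int (idx q \<tau>')" by simp
  also have "\<dots> \<longleftrightarrow> pos (int p) \<tau> < pos (int q) \<tau>'"
    using pos_bounds(1)[of "int p" \<tau>] pos_bounds(1)[of "int q" \<tau>'] unfolding int_idx
    by (cases "pos (int p) \<tau> > 0"; cases "pos (int q) \<tau>' > 0") auto
  finally show ?thesis .
qed

lemma idx_opposite: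
  "pos (int q) \<sigma> = - pos (int p) \<tau> \<Longrightarrow> int (idx p \<tau>) + int (idx q \<sigma>) = 2 * n - 1"
  using pos_bounds(1)[of "int p" \<tau>] unfolding int_idx by simp

lemma idx_eq_iff: "idx p \<tau> = idx q \<tau>' \<longleftrightarrow> pos (int p) \<tau> = pos (int q) \<tau>'"
  using idx_less_iff[of p \<tau> q \<tau>'] idx_less_iff[of q \<tau>' p \<tau>] by linarith

lemma idx_less: "idx p \<tau> < nat (2 * n)"
proof -
  have "int (idx p \<tau>) < 2 * n" using pos_bounds[of "int p" \<tau>] unfolding int_idx by (cases "pos (int p) \<tau> > 0") auto
  then show ?thesis by linarith
qed

lemma points_congruent:
  assumes "p \<in> points" "q \<in> points" "int p = int q + 2 * n * m"
  shows "p = q"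
proof -
  have "\<bar>int p - int q\<bar> < \<bar>2 * n\<bar>" using assms n_gt_1 by (auto simp: points_def)
  moreover have "2 * n dvd int p - int q" using assms(3) by simp
  ultimately have "int p - int q = 0" using dvd_imp_le_int by (meson not_le)
  then show ?thesis by simp
qed

lemma card_points: "card points = nat (2 * n)"
  by (simp add: points_def)

lemma idx_bij: "bij_betw (\<lambda>p. idx p \<tau>) points {..<nat (2 * n)}"
proof -
  have inj: "inj_on (\<lambda>p. idx p \<tau>) points"
  proof (rule inj_onI)
    fix p q assume pq: "p \<in> points" "q \<in> points" "idx p \<tau> = idx q \<tau>"
    then obtain m where "int p = int q + 2 * n * m" using pos_eqD unfolding idx_eq_iff by blast
    with pq(1,2) show "p = q" by (rule points_congruent)
  qed
  have "(\<lambda>p. idx p \<tau>) ` points = {..<nat (2 * n)}"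
  proof (rule card_subset_eq)
    show "(\<lambda>p. idx p \<tau>) ` points \<subseteq> {..<nat (2 * n)}" using idx_less by auto
    show "card ((\<lambda>p. idx p \<tau>) ` points) = card {..<nat (2 * n)}"
      using inj by (simp add: card_image card_points)
  qed simp
  then show ?thesis using inj by (simp add: bij_betw_def)
qed

lemma length_seq: "length (seq \<tau>) = nat (2 * n)"
  by (simp add: seq_def)

lemma seq_idx: "p \<in> points \<Longrightarrow> seq \<tau> ! idx p \<tau> = p"
  using idx_bij[of \<tau>] idx_less by (simp add: seq_def bij_betw_def inv_into_f_f[of "\<lambda>p. idx p \<tau>"])

lemma seq_permutation: "seq \<tau> \<in> permutations_of_set points"
proof -
  have b: "bij_betw (inv_into points (\<lambda>p. idx p \<tau>)) {..<nat (2 * n)} points"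
    using idx_bij by (rule bij_betw_inv_into)
  show ?thesis
  proof (rule permutations_of_setI)
    show "set (seq \<tau>) = points"
      using bij_betw_imp_surj_on[OF b] by (simp only: seq_def set_map set_upt lessThan_atLeast0)
    show "distinct (seq \<tau>)" unfolding seq_def distinct_map
      using bij_betw_imp_inj_on[OF b] by (simp only: set_upt lessThan_atLeast0 distinct_upt)
  qed
qed

lemma distinct_seq: "distinct (seq \<tau>)" and set_seq: "set (seq \<tau>) = points"
  using permutations_of_setD[OF seq_permutation] by simp_all

lemma ex_idx: "k < nat (2 * n) \<Longrightarrow> \<exists>p\<in>points. idx p \<tau> = k"
proof -
  assume "k < nat (2 * n)"
  then have "k \<in> (\<lambda>p. idx p \<tau>) ` points" unfolding bij_betw_imp_surj_on[OF idx_bij] by simp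
  then show ?thesis by blast
qed

lemma seq_antiperiod: "seq (\<tau> + 2 * n) = rev (seq \<tau>)"
proof (rule nth_equalityI)
  fix k assume k: "k < length (seq (\<tau> + 2 * n))"
  then obtain p where p: "p \<in> points" "idx p (\<tau> + 2 * n) = k" using ex_idx by (auto simp: length_seq)
  have "int (idx p \<tau>) + int k = 2 * n - 1"
    using p(2) idx_opposite[OF pos_add_period[of "int p" \<tau>]] by simp
  then have "idx p \<tau> = nat (2 * n) - Suc k" by linarith
  then show "seq (\<tau> + 2 * n) ! k = rev (seq \<tau>) ! k"
    using k p seq_idx[OF p(1), of \<tau>] seq_idx[OF p(1), of "\<tau> + 2 * n"] by (simp add: rev_nth length_seq)
qed (simp add: length_seq)

definition switches :: "int \<Rightarrow> switch set" where
  "switches \<tau> = crossings \<tau> \<union> {(idx p (\<tau> - 1), idx p \<tau>) | p. p \<in> points \<and>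
     idx p (\<tau> - 1) \<notin> (\<Union>s\<in>crossings \<tau>. switch_indices s) \<and> idx p \<tau> = Suc (idx p (\<tau> - 1))}"

lemma cross_inj: "cross i = cross j \<Longrightarrow> i = j"
  using cross_strict_mono by (simp add: strict_mono_eq)

lemma width_bounds: "0 < D (i + 1) - D i" "D (i + 1) - D i < n"
  using D_less_iff[of i "i + 1"] D_less_iff[of "i + 1" "i + t"] D_shift[of i] two_blocks by auto

lemma in_crossing_iff:
  assumes "\<tau> = cross i"
  shows "idx p (\<tau> - 1) \<in> (\<Union>s\<in>crossings \<tau>. switch_indices s) \<longleftrightarrow>
    \<bar>pos (int p) (\<tau> - 1)\<bar> \<le> D (i + 1) - D i"
proof -
  have "crossings \<tau> = {(nat (n - (D (i + 1) - D i)), nat (n + (D (i + 1) - D i) - 1))}"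
    using assms cross_inj by (auto simp: crossings_def)
  then show ?thesis using width_bounds[of i] pos_bounds[of "int p" "\<tau> - 1"] int_idx[of p "\<tau> - 1"]
    by (auto simp: switch_indices_def nat_le_iff le_nat_iff split: if_splits)
qed

lemma outside_crossing:
  assumes "idx p (\<tau> - 1) \<notin> (\<Union>s\<in>crossings \<tau>. switch_indices s)"
  shows "0 < pos (int p) \<tau> \<longleftrightarrow> 0 < pos (int p) (\<tau> - 1)" "\<bar>pos (int p) \<tau> - pos (int p) (\<tau> - 1)\<bar> \<le> 1"
proof -
  have "D (i + 1) - D i < \<bar>pos (int p) (\<tau> - 1)\<bar>" if "\<tau> = cross i" for i
    using assms in_crossing_iff[OF that, of p] by simp
  then show "0 < pos (int p) \<tau> \<longleftrightarrow> 0 < pos (int p) (\<tau> - 1)" "\<bar>pos (int p) \<tau> - pos (int p) (\<tau> - 1)\<bar> \<le> 1"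
    using pos_step_outside_crossing[of \<tau> "int p"] by (metis sgn_greater, blast)
qed

lemma obtained_switches: "obtained_by_switches (seq (\<tau> - 1)) (seq \<tau>) (switches \<tau>)"
  unfolding switches_def
proof (rule obtained_by_switchesI)
  show "bij_betw (\<lambda>p. idx p (\<tau> - 1)) points {..<nat (2 * n)}" "bij_betw (\<lambda>p. idx p \<tau>) points {..<nat (2 * n)}"
    by (rule idx_bij)+
  show "length (seq (\<tau> - 1)) = nat (2 * n)" "length (seq \<tau>) = nat (2 * n)" by (simp_all add: length_seq)
  show "a < b \<and> b < nat (2 * n)" if ab: "(a, b) \<in> crossings \<tau>" for a b
  proof -
    obtain i where "a = nat (n - (D (i + 1) - D i))" "b = nat (n + (D (i + 1) - D i) - 1)"
      using ab by (auto simp: crossings_def)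
    then show ?thesis using width_bounds[of i] by auto
  qed
  show "disjoint_family_on switch_indices (crossings \<tau>)"
    by (auto simp: disjoint_family_on_def crossings_def dest!: cross_inj)
  show "idx p \<tau> = a + b - idx p (\<tau> - 1)"
    if ab: "(a, b) \<in> crossings \<tau>" "a \<le> idx p (\<tau> - 1)" "idx p (\<tau> - 1) \<le> b" for a b p
  proof -
    obtain i where i: "\<tau> = cross i" "a = nat (n - (D (i + 1) - D i))" "b = nat (n + (D (i + 1) - D i) - 1)"
      using ab(1) by (auto simp: crossings_def)
    have "idx p (\<tau> - 1) \<in> (\<Union>s\<in>crossings \<tau>. switch_indices s)"
      using ab by (force simp: switch_indices_def)
    then have "pos (int p) \<tau> = - pos (int p) (\<tau> - 1)"
      using in_crossing_iff[OF i(1)] pos_crossing_reversal[of "int p" i] i(1) by simp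
    moreover have "int (a + b) = 2 * n - 1" using i width_bounds[of i] by simp
    ultimately show ?thesis
      using idx_opposite[of p \<tau> p "\<tau> - 1"] by linarith
  qed
  show "idx p \<tau> \<le> Suc (idx p (\<tau> - 1)) \<and> idx p (\<tau> - 1) \<le> Suc (idx p \<tau>)"
    if "idx p (\<tau> - 1) \<notin> (\<Union>s\<in>crossings \<tau>. switch_indices s)" for p
  proof -
    have "int (idx p \<tau>) - int (idx p (\<tau> - 1)) = pos (int p) \<tau> - pos (int p) (\<tau> - 1)"
      using outside_crossing(1)[OF that] by (simp add: int_idx)
    then show ?thesis using outside_crossing(2)[OF that] by linarith
  qed
qed (erule seq_idx)+

lemma move_seq: "move seq \<tau> = switches \<tau>"
  using distinct_seq obtained_switches by (rule move_eqI)

lemma switches_nonempty: "switches \<tau> \<noteq> {}"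
proof
  assume empty: "switches \<tau> = {}"
  have same: "pos (int p) \<tau> = pos (int p) (\<tau> - 1)" if p: "p \<in> points" for p
  proof -
    have "seq \<tau> ! idx p \<tau> = seq (\<tau> - 1) ! idx p \<tau>"
      using obtained_switches[of \<tau>] idx_less unfolding empty obtained_by_switches_def length_seq by auto
    then have "seq (\<tau> - 1) ! idx p \<tau> = seq (\<tau> - 1) ! idx p (\<tau> - 1)" using p by (simp add: seq_idx)
    then have "idx p \<tau> = idx p (\<tau> - 1)"
      using distinct_seq idx_less by (simp add: nth_eq_iff_index_eq length_seq)
    then show ?thesis by (simp add: idx_eq_iff)
  qed
  obtain v where v: "pos v \<tau> \<noteq> pos v (\<tau> - 1)" using particle_moves by blast
  obtain m where "1 \<le> v + 2 * n * m" "v + 2 * n * m < 1 + 2 * n" using principal_period by blast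
  then have "nat (v + 2 * n * m) \<in> points" "int (nat (v + 2 * n * m)) = v + 2 * n * m"
    by (auto simp: points_def)
  then show False using same[of "nat (v + 2 * n * m)"] v by (simp add: pos_shift_mult_point)
qed

lemma participate_iff_order_changes:
  assumes "p \<in> points" "q \<in> points" "p \<noteq> q"
  shows "participate_together seq \<tau> p q \<longleftrightarrow>
    (idx p \<tau> < idx q \<tau>) \<noteq> (idx p (\<tau> - 1) < idx q (\<tau> - 1))"
proof -
  have index: "r \<in> switch_points (seq (\<tau> - 1)) s \<longleftrightarrow> idx r (\<tau> - 1) \<in> switch_indices s"
    if r: "r \<in> points" and s: "s \<in> switches \<tau>" for r s
  proof -
    obtain a b where ab: "s = (a, b)" by (cases s)
    then have "b < nat (2 * n)" using obtained_by_switchesD(2)[OF obtained_switches, of a b \<tau>] s by (simp add: length_seq)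
    then have "k \<in> switch_indices s \<Longrightarrow> k < nat (2 * n)" for k by (auto simp: ab switch_indices_def)
    then have at_idx: "k = idx r (\<tau> - 1)" if "k \<in> switch_indices s" "seq (\<tau> - 1) ! k = r" for k
      using that idx_less[of r "\<tau> - 1"] seq_idx[OF r, of "\<tau> - 1"]
        nth_eq_iff_index_eq[OF distinct_seq, of k "\<tau> - 1" "idx r (\<tau> - 1)"] by (simp add: length_seq)
    show ?thesis
    proof
      assume "r \<in> switch_points (seq (\<tau> - 1)) s"
      then obtain k where "k \<in> switch_indices s" "seq (\<tau> - 1) ! k = r"
        unfolding switch_points_def by blast
      then show "idx r (\<tau> - 1) \<in> switch_indices s" using at_idx[of k] by simp
    next
      assume "idx r (\<tau> - 1) \<in> switch_indices s"
      then show "r \<in> switch_points (seq (\<tau> - 1)) s"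
        using seq_idx[OF r, of "\<tau> - 1"] unfolding switch_points_def by (metis image_eqI)
    qed
  qed
  have *: "(\<exists>s\<in>switches \<tau>. idx r (\<tau> - 1) \<in> switch_indices s \<and> idx r' (\<tau> - 1) \<in> switch_indices s) \<longleftrightarrow>
      idx r' \<tau> < idx r \<tau>" if "r \<in> points" "r' \<in> points" "idx r (\<tau> - 1) < idx r' (\<tau> - 1)" for r r'
    by (rule obtained_by_switches_order[OF obtained_switches distinct_seq])
      (use that in \<open>simp_all add: length_seq idx_less seq_idx\<close>)
  have P: "participate_together seq \<tau> p q \<longleftrightarrow>
      (\<exists>s\<in>switches \<tau>. idx p (\<tau> - 1) \<in> switch_indices s \<and> idx q (\<tau> - 1) \<in> switch_indices s)"
    unfolding participate_together_def move_seq using index assms by auto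
  have ne: "idx p \<sigma> \<noteq> idx q \<sigma>" for \<sigma> using assms seq_idx by metis
  show ?thesis
  proof (cases "idx p (\<tau> - 1) < idx q (\<tau> - 1)")
    case True
    then show ?thesis using *[of p q] assms ne[of \<tau>] unfolding P by auto
  next
    case False
    then have "idx q (\<tau> - 1) < idx p (\<tau> - 1)" using ne[of "\<tau> - 1"] by linarith
    then show ?thesis using *[of q p] assms False unfolding P by auto
  qed
qed

text \<open>
  The order of two points changes exactly at the times that are congruent to a fixed one modulo
  \<open>2 * n\<close>, and a halfperiod contains exactly one such time.
\<close>

lemma halfperiod: "halfperiod_length points seq (nat (2 * n))"
  unfolding halfperiod_length_def
proof (intro conjI ballI impI allI)
  show "nat (2 * n) > 0" using n_gt_1 by simp
  show "seq (i + int (nat (2 * n))) = rev (seq i)" for i using n_gt_1 seq_antiperiod by simp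
  fix p q i assume pq: "p \<in> points" "q \<in> points" "p \<noteq> q"
  have "int p < int q + 2 * n" "int q < int p + 2 * n" using pq by (auto simp: points_def)
  then have "\<exists>c. below_from (int p) (int q) c \<or> below_from (int q) (int p) c"
    using pq(3) ex_below_from[of "int p" "int q"] ex_below_from[of "int q" "int p"] by (cases p q rule: linorder_cases) auto
  then obtain c where c: "below_from (int p) (int q) c" using below_from_swap by blast
  have part: "participate_together seq j p q \<longleftrightarrow> 2 * n dvd j - c" for j
    unfolding participate_iff_order_changes[OF pq] idx_less_iff order_iff_even[OF c]
    using parity_of_quotient_changes_iff[of "2 * n" "j - c"] n_gt_1 by (simp add: algebra_simps)
  obtain m where m: "i + 1 \<le> c + 2 * n * m" "c + 2 * n * m < i + 1 + 2 * n" using principal_period by blast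
  show "\<exists>!j. j \<in> {i<..i + int (nat (2 * n))} \<and> participate_together seq j p q"
  proof (rule ex1I[of _ "c + 2 * n * m"])
    show "c + 2 * n * m \<in> {i<..i + int (nat (2 * n))} \<and> participate_together seq (c + 2 * n * m) p q"
      using m n_gt_1 by (auto simp: part)
    fix j assume j: "j \<in> {i<..i + int (nat (2 * n))} \<and> participate_together seq j p q"
    then have "2 * n dvd j - c" using part by blast
    then have "2 * n dvd (j - c) - 2 * n * m" using dvd_triv_left by (rule dvd_diff)
    moreover have "i < j" "j \<le> i + 2 * n" using j n_gt_1 by simp_all
    then have "\<bar>(j - c) - 2 * n * m\<bar> < \<bar>2 * n\<bar>" using m n_gt_1 by linarith
    ultimately have "(j - c) - 2 * n * m = 0" using dvd_imp_le_int by (meson not_le)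
    then show "j = c + 2 * n * m" by simp
  qed
qed

lemma allowable: "allowable_sequence points seq"
  unfolding allowable_sequence_def
proof (intro conjI allI)
  show "finite points" by (simp add: points_def)
  show "\<exists>S. S \<noteq> {} \<and> obtained_by_switches (seq (i - 1)) (seq i) S" for i
    using switches_nonempty obtained_switches by blast
  show "\<exists>h. halfperiod_length points seq h" using halfperiod by blast
qed (rule seq_permutation)

lemma position_seq: "p \<in> points \<Longrightarrow> position (seq \<tau>) p = Suc (idx p \<tau>)"
  unfolding position_def using seq_idx[of p \<tau>] idx_less[of p \<tau>] distinct_seq[of \<tau>]
  by (auto simp: length_seq nth_eq_iff_index_eq intro!: the_equality)

lemma symmetric: "centrally_symmetric points seq"
  unfolding centrally_symmetric_def card_points
proof (intro conjI ballI)
  show "even (nat (2 * n))" using n_gt_1 by (simp add: even_nat_iff)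
  fix p assume p: "p \<in> points"
  define p' where "p' = (if int p \<le> n then p + nat n else p - nat n)"
  have p': "p' \<in> points" using p n_gt_1 by (auto simp: points_def p'_def)
  have "int p' = int p + n \<or> int p = int p' + n" using n_gt_1 by (auto simp: p'_def)
  then have opp: "pos (int p') \<tau> = - pos (int p) \<tau>" for \<tau> by (auto simp: pos_conjugate)
  have "int (idx p \<tau>) + int (idx p' \<tau>) = 2 * n - 1" for \<tau>
    using idx_opposite[OF opp] .
  then have "idx p \<tau> + idx p' \<tau> + 1 = nat (2 * n)" for \<tau>
    using n_gt_1 by (smt (verit) int_nat_eq of_nat_1 of_nat_add of_nat_eq_iff)
  then show "\<exists>p'\<in>points. \<forall>\<tau>. position (seq \<tau>) p + position (seq \<tau>) p' = nat (2 * n) + 1"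
    using p p' by (intro bexI[of _ p']) (simp_all add: position_seq)
qed

text \<open>
  A transposition is never centered: it would carry a point across the center outside of a crossing.
\<close>

lemma switches_cases:
  assumes "s \<in> switches \<tau>"
  obtains (crossing) i where "\<tau> = cross i" "crossing_switch (nat (2 * n)) s"
      "switch_size s = 2 * nat (D (i + 1) - D i)"
  | (transposition) "\<not> crossing_switch (nat (2 * n)) s" "transposition_switch s"
proof (cases "s \<in> crossings \<tau>")
  case True
  then obtain i where i: "\<tau> = cross i" "s = (nat (n - (D (i + 1) - D i)), nat (n + (D (i + 1) - D i) - 1))"
    by (auto simp: crossings_def)
  show thesis
  proof (rule crossing[OF i(1)])
    show "crossing_switch (nat (2 * n)) s" "switch_size s = 2 * nat (D (i + 1) - D i)"
      using width_bounds[of i] by (auto simp: i(2) crossing_switch_def switch_size_def switch_indices_def)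
  qed
next
  case False
  then obtain p where p: "s = (idx p (\<tau> - 1), idx p \<tau>)" "idx p \<tau> = Suc (idx p (\<tau> - 1))"
      "idx p (\<tau> - 1) \<notin> (\<Union>s\<in>crossings \<tau>. switch_indices s)"
    using assms by (auto simp: switches_def)
  have "int (idx p (\<tau> - 1)) \<noteq> n - 1"
    using outside_crossing(1)[OF p(3)] p(2) int_idx[of p \<tau>] int_idx[of p "\<tau> - 1"]
      pos_bounds(1)[of "int p" \<tau>] pos_bounds(1)[of "int p" "\<tau> - 1"]
    by (cases "0 < pos (int p) (\<tau> - 1)") simp_all
  then have "\<not> crossing_switch (nat (2 * n)) s" using p n_gt_1 by (auto simp: crossing_switch_def)
  then show thesis using transposition p
    by (auto simp: transposition_switch_def switch_size_def switch_indices_def)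
qed

lemma general_position: "noncentral_general_position points seq"
  unfolding noncentral_general_position_def move_seq card_points
proof (intro allI ballI)
  fix \<tau> s assume "s \<in> switches \<tau>"
  then show "crossing_switch (nat (2 * n)) s \<or> transposition_switch s"
    by (cases rule: switches_cases) simp_all
qed

lemma near_critical: "the_halfperiod_length points seq = card points"
  unfolding card_points by (rule the_halfperiod_length_eqI[OF allowable halfperiod])

lemma crossing_size_at_cross:
  "(THE d. \<exists>s\<in>move seq (cross i). crossing_switch (card points) s \<and> switch_size s = 2 * d) = nat (D (i + 1) - D i)"
proof (rule the_equality)
  define s where "s = (nat (n - (D (i + 1) - D i)), nat (n + (D (i + 1) - D i) - 1))"
  have "s \<in> switches (cross i)" by (auto simp: s_def switches_def crossings_def)
  moreover have "crossing_switch (nat (2 * n)) s" "switch_size s = 2 * nat (D (i + 1) - D i)"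
    using width_bounds[of i] by (auto simp: s_def crossing_switch_def switch_size_def switch_indices_def)
  ultimately show "\<exists>s\<in>move seq (cross i). crossing_switch (card points) s \<and> switch_size s = 2 * nat (D (i + 1) - D i)"
    unfolding move_seq card_points by blast
next
  fix d assume "\<exists>s\<in>move seq (cross i). crossing_switch (card points) s \<and> switch_size s = 2 * d"
  then obtain s where s: "s \<in> switches (cross i)" "crossing_switch (nat (2 * n)) s" "switch_size s = 2 * d"
    unfolding move_seq card_points by blast
  show "d = nat (D (i + 1) - D i)" using s(1)
  proof (cases rule: switches_cases)
    case (crossing j)
    then show ?thesis using s(3) cross_inj[of i j] by simp
  qed (use s in blast)
qed

lemma crossing_move_iff: "(\<exists>s\<in>move seq \<tau>. crossing_switch (card points) s) \<longleftrightarrow> \<tau> \<in> range cross"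
proof
  assume "\<exists>s\<in>move seq \<tau>. crossing_switch (card points) s"
  then obtain s where s: "s \<in> switches \<tau>" "crossing_switch (nat (2 * n)) s"
    unfolding move_seq card_points by blast
  from s(1) show "\<tau> \<in> range cross" by (cases rule: switches_cases) (use s(2) in auto)
next
  assume "\<tau> \<in> range cross"
  then obtain i where "\<tau> = cross i" by blast
  then have "(nat (n - (D (i + 1) - D i)), nat (n + (D (i + 1) - D i) - 1)) \<in> switches \<tau>"
    by (auto simp: switches_def crossings_def)
  moreover have "crossing_switch (nat (2 * n)) (nat (n - (D (i + 1) - D i)), nat (n + (D (i + 1) - D i) - 1))"
    using width_bounds[of i] by (auto simp: crossing_switch_def)
  ultimately show "\<exists>s\<in>move seq \<tau>. crossing_switch (card points) s" unfolding move_seq card_points by blast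
qed

text \<open>
  The normalization \<open>D 0 = 0\<close> puts the crossing times of the blocks \<open>0, \<dots>, t - 1\<close>, and no others, between
  1 and \<open>2 * n\<close>: the neighbouring ones are \<open>cross (- 1) = D (- 1) < 0\<close> and
  \<open>cross t = n + D (t + 1) > 2 * n\<close>.
\<close>

lemma signature:
  assumes "D 0 = 0"
  shows "central_signature points seq = map (\<lambda>i. nat (D (i + 1) - D i)) [0..t - 1]"
proof -
  have D: "D (- 1) < 0" "D 1 > 0" "D t = n" "D (t - 1) < n" "D (t + 1) > n"
    using assms D_shift[of 0] D_less_iff[of "- 1" 0] D_less_iff[of 0 1] D_less_iff[of "t - 1" t]
      D_less_iff[of t "t + 1"] by simp_all
  have inside: "cross i \<in> {1..2 * n} \<longleftrightarrow> i \<in> {0..t - 1}" for i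
  proof -
    have "cross (- 1) < 1" "1 \<le> cross 0" "cross (t - 1) \<le> 2 * n" "2 * n < cross t"
      using D assms by (simp_all add: cross_def)
    moreover have "cross i < cross j \<longleftrightarrow> i < j" "cross i \<le> cross j \<longleftrightarrow> i \<le> j" for i j
      using cross_strict_mono by (simp_all add: strict_mono_less strict_mono_less_eq)
    ultimately show ?thesis
      by (smt (verit, best) atLeastAtMost_iff)
  qed
  have "filter (\<lambda>\<tau>. \<tau> \<in> range cross) [1..2 * n] = map cross [0..t - 1]"
  proof (rule sorted_distinct_set_unique)
    show "sorted (map cross [0..t - 1])"
      unfolding sorted_map using cross_strict_mono
      by (intro sorted_wrt_mono_rel[OF _ sorted_upto]) (auto simp: strict_mono_less_eq)
    show "distinct (map cross [0..t - 1])"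
      using cross_inj by (auto simp: distinct_map inj_on_def)
    show "set (filter (\<lambda>\<tau>. \<tau> \<in> range cross) [1..2 * n]) = set (map cross [0..t - 1])"
    proof -
      have "\<tau> \<in> range cross \<and> \<tau> \<in> {1..2 * n} \<longleftrightarrow> \<tau> \<in> cross ` {0..t - 1}" for \<tau>
        using inside by blast
      then show ?thesis by auto
    qed
  qed (simp_all add: sorted_wrt_filter)
  moreover have "int (the_halfperiod_length points seq) = 2 * n"
    using n_gt_1 by (simp add: near_critical card_points)
  ultimately show ?thesis
    unfolding central_signature_def crossing_move_iff
    by (simp add: crossing_size_at_cross comp_def)
qed

end

section \<open>Prescribing the central signature\<close>

theorem theorem3p3:
  fixes d :: "nat list"
  assumes "length d > 1"
    and "\<forall>k\<in>set d. k > 0"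
  shows "\<exists>(P :: nat set) \<pi>.
           allowable_sequence P \<pi> \<and>
           centrally_symmetric P \<pi> \<and>
           noncentral_general_position P \<pi> \<and>
           even_near_critical P \<pi> \<and>
           central_signature P \<pi> = d"
proof -
  define t where "t = int (length d)"
  define n where "n = int (sum_list d)"
  \<comment> \<open>Partial sums of \<open>d\<close>, continued so that the differences have period \<open>t\<close>.\<close>
  define D where "D i = n * (i div t) + int (sum_list (take (nat (i mod t)) d))" for i
  have t: "t > 1" using assms by (simp add: t_def)
  have step: "D (i + 1) = D i + int (d ! nat (i mod t))" for i
  proof -
    define r where "r = nat (i mod t)"
    have r: "int r = i mod t" "r < length d"
    proof -
      show r: "int r = i mod t" using t by (simp add: r_def)
      have "i mod t < t" using t by simp
      then have "int r < int (length d)" using r by (simp add: t_def)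
      then show "r < length d" by simp
    qed
    have sum: "sum_list (take (Suc r) d) = sum_list (take r d) + d ! r"
      using r by (simp add: take_Suc_conv_app_nth)
    have i: "i = int r + t * (i div t)" unfolding r(1) by simp
    show ?thesis
    proof (cases "Suc r = length d")
      case True
      then have "i + 1 = t * (i div t + 1)" using i by (simp add: t_def algebra_simps)
      then have "(i + 1) div t = i div t + 1" "(i + 1) mod t = 0" using t by simp_all
      moreover have "sum_list d = sum_list (take r d) + d ! r" using sum True by simp
      ultimately show ?thesis unfolding D_def r_def[symmetric] by (simp add: n_def algebra_simps)
    next
      case False
      then have "int (Suc r) < t" using r by (simp add: t_def)
      moreover have e: "i + 1 = int (Suc r) + t * (i div t)" using i by simp
      ultimately have succ: "(i + 1) div t = i div t" "(i + 1) mod t = int (Suc r)"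
        by (subst e, simp)+
      have "D (i + 1) = n * (i div t) + int (sum_list (take (Suc r) d))"
        unfolding D_def succ nat_int ..
      also have "\<dots> = D i + int (d ! r)" unfolding D_def r_def[symmetric] sum by simp
      finally show ?thesis unfolding r_def .
    qed
  qed
  have pos: "d ! nat (i mod t) > 0" for i
  proof -
    have "0 \<le> i mod t" "i mod t < t" using t by simp_all
    then have "nat (i mod t) < length d" unfolding t_def by linarith
    then have "d ! nat (i mod t) \<in> set d" by (rule nth_mem)
    then show ?thesis using assms(2) by blast
  qed
  have add: "D i < D (i + int (Suc k))" for i k
  proof (induction k)
    case 0
    then show ?case using step[of i] pos[of i] by simp
  next
    case (Suc k)
    then show ?case using step[of "i + int (Suc k)"] pos[of "i + int (Suc k)"] by (simp add: ac_simps)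
  qed
  interpret block_cuts D t n
  proof
    show "strict_mono D"
    proof (rule strict_monoI)
      fix i j :: int assume "i < j"
      then show "D i < D j" using add[of i "nat (j - i - 1)"] by simp
    qed
    show "D (i + t) = D i + n" for i using t by (simp add: D_def algebra_simps)
  qed (rule t)
  have "central_signature points seq = map (\<lambda>i. d ! nat (i mod t)) [0..t - 1]"
    using signature by (simp add: step) (simp add: D_def)
  also have "\<dots> = d"
    by (rule nth_equalityI) (use t in \<open>auto simp: t_def nth_upto\<close>)
  finally show ?thesis
    using allowable symmetric general_position near_critical unfolding even_near_critical_def by blast
qed

end
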